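(* Let $(P,\circ_\lambda,[\cdot_\lambda\cdot])$ be a (noncommutative) Poisson conformal algebra. Then $\mathrm{Coeff}\,P$ with the operations determined, for $a,b\in P$ and $m,n\in\mathbb{Z}$, by $$a_m\circ b_n=\sum_{j\in\mathbb{N}}\binom{m}{j}(a_{(j)}b)_{m+n-j},\qquad [a_m,b_n]=\sum_{j\in\mathbb{N}}\binom{m}{j}(a_{[j]}b)_{m+n-j}$$ is a (noncommutative) Poisson algebra. The statement holds in both versions: with the word "(noncommutative)" included throughout, or omitted throughout.
   Context: All vector spaces are over $\mathbb{C}$; $\mathbb{N}=\{0,1,2,\dots\}$. A conformal algebra is a $\mathbb{C}[\partial]$-module $A$ with a $\mathbb{C}$-bilinear map $A\times A\to A[\lambda]$, $(a,b)\mapsto a_\lambda b$, such that $(\partial a)_\lambda b=-\lambda\, a_\lambda b$ and $a_\lambda(\partial b)=(\partial+\lambda)(a_\lambda b)$. An associative conformal algebra is a conformal algebra $(A,\circ_\lambda)$ with $a\circ_\lambda(b\circ_\mu c)=(a\circ_\lambda b)\circ_{\lambda+\mu}c$; it is commutative if $a\circ_\lambda b=b\circ_{-\lambda-\partial}a$ (with $\partial$ moved to the left, acting on coefficients). A Lie conformal algebra is a conformal algebra $(A,[\cdot_\lambda\cdot])$ with $[a_\lambda b]=-[b_{-\lambda-\partial}a]$ and $[a_\lambda[b_\mu c]]=[[a_\lambda b]_{\lambda+\mu}c]+[b_\mu[a_\lambda c]]$. A Poisson conformal algebra is a $\mathbb{C}[\partial]$-module with a commutative associative conformal structure $\circ_\lambda$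 and a Lie conformal structure $[\cdot_\lambda\cdot]$ satisfying $[a_\lambda(b\circ_\mu c)]=[a_\lambda b]\circ_{\lambda+\mu}c+b\circ_\mu[a_\lambda c]$; a noncommutative Poisson conformal algebra is the same without requiring commutativity of $\circ_\lambda$. The $n$-th products $a_{(n)}b$, $a_{[n]}b\in P$ are defined by $a\circ_\lambda b=\sum_{n\ge0}\frac{\lambda^n}{n!}a_{(n)}b$ and $[a_\lambda b]=\sum_{n\ge0}\frac{\lambda^n}{n!}a_{[n]}b$. For a $\mathbb{C}[\partial]$-module $P$, $\mathrm{Coeff}\,P$ is the quotient of the vector space with basis the symbols $a_n$ ($a\in P$, $n\in\mathbb{Z}$) by the subspace spanned by all elements $(\alpha a)_n-\alpha a_n$, $(a+b)_n-a_n-b_n$, $(\partial a)_n+na_{n-1}$ with $a,b\in P$, $\alpha\in\mathbb{C}$, $n\in\mathbb{Z}$. A (noncommutative) Poisson algebra is a vector space with a commutative associative (respectively, for "noncommutative", an associative) product $\circ$ and a Lie bracket $[\cdot,\cdot]$ with $[a,b\circ c]=[a,b]\circ c+b\circ[a,c]$. *)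

theory Defs
  imports
    Complex_Main
    "HOL-Computational_Algebra.Polynomial"
    "HOL-Library.Groups_Big_Fun"
    "HOL-Library.Poly_Mapping"
begin

section \<open>Modules over \<open>\<complex>[\<partial>]\<close>\<close>

text \<open>The axioms are those of the locale \<^locale>\<open>module\<close> with ring of scalars \<^typ>\<open>complex poly\<close>.\<close>

class complex_del_module = ab_group_add +
  fixes pscale :: "complex poly \<Rightarrow> 'a \<Rightarrow> 'a"
  assumes pscale_right_distrib: "pscale p (x + y) = pscale p x + pscale p y"
    and pscale_left_distrib: "pscale (p + q) x = pscale p x + pscale q x"
    and pscale_pscale: "pscale p (pscale q x) = pscale (p * q) x"
    and pscale_one: "pscale 1 x = x"

lemma module_pscale: "module (pscale :: complex poly \<Rightarrow> 'a \<Rightarrow> 'a::complex_del_module)"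
  by unfold_locales
    (simp_all add: pscale_right_distrib pscale_left_distrib pscale_pscale pscale_one)

definition cscale :: "complex \<Rightarrow> 'a::complex_del_module \<Rightarrow> 'a" where
  "cscale c = pscale [:c:]"

definition del :: "'a::complex_del_module \<Rightarrow> 'a" where
  "del = pscale [:0, 1:]"

lemma vector_space_cscale: "vector_space (cscale :: complex \<Rightarrow> 'a \<Rightarrow> 'a::complex_del_module)"
  unfolding cscale_def
  by unfold_locales
    (simp_all add: pscale_right_distrib pscale_pscale pscale_one pscale_left_distrib [symmetric]
      one_pCons [symmetric] mult.commute)

definition bilinear_map ::
    "(complex \<Rightarrow> 'a::ab_group_add \<Rightarrow> 'a) \<Rightarrow> (complex \<Rightarrow> 'b::ab_group_add \<Rightarrow> 'b)
      \<Rightarrow> ('a \<Rightarrow> 'a \<Rightarrow> 'b) \<Rightarrow> bool" where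
  "bilinear_map s t f \<longleftrightarrow>
    (\<forall>x. Vector_Spaces.linear s t (\<lambda>y. f x y)) \<and> (\<forall>y. Vector_Spaces.linear s t (\<lambda>x. f x y))"


section \<open>Conformal algebras\<close>

text \<open>
  For a module \<open>A\<close>, \<open>A[\<lambda>]\<close> is \<^typ>\<open>'a poly\<close> and \<open>A[\<lambda>,\<mu>] = A[\<lambda>][\<mu>]\<close> is
  \<^typ>\<open>'a poly poly\<close>, with \<open>\<mu>\<close> the outer variable. The element \<open>a \<circ>\<^sub>\<lambda> b\<close> is \<open>f a b\<close> for
  \<open>f :: 'a \<Rightarrow> 'a \<Rightarrow> 'a poly\<close>.
\<close>

text \<open>
  \<open>poly_subst T \<iota> p = (\<Sum>k. T\<^sup>k (\<iota> p\<^sub>k))\<close> for \<open>p = (\<Sum>k. \<nu>\<^sup>k p\<^sub>k)\<close>: every coefficient is mapped by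
  \<open>\<iota>\<close>, and the variable \<open>\<nu>\<close> is replaced by the operator \<open>T\<close>, written on the left.
\<close>

definition poly_subst :: "('b \<Rightarrow> 'b) \<Rightarrow> ('a::zero \<Rightarrow> 'b::comm_monoid_add) \<Rightarrow> 'a poly \<Rightarrow> 'b" where
  "poly_subst T \<iota> p = (\<Sum>k\<le>degree p. (T ^^ k) (\<iota> (coeff p k)))"

text \<open>The operator \<open>-\<lambda> - \<partial>\<close> on \<open>A[\<lambda>]\<close>, where \<open>\<partial>\<close> acts on coefficients.\<close>

definition minus_lam_del :: "'a::complex_del_module poly \<Rightarrow> 'a poly" where
  "minus_lam_del p = - pCons 0 p - map_poly del p"

text \<open>Multiplication by \<open>\<lambda>\<close>, by \<open>\<mu>\<close> and by \<open>\<lambda> + \<mu>\<close> on \<open>A[\<lambda>,\<mu>]\<close>.\<close>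

definition lam :: "'a::ab_group_add poly poly \<Rightarrow> 'a poly poly" where
  "lam p = map_poly (pCons 0) p"

definition mu :: "'a::ab_group_add poly poly \<Rightarrow> 'a poly poly" where
  "mu p = pCons 0 p"

definition lam_mu :: "'a::ab_group_add poly poly \<Rightarrow> 'a poly poly" where
  "lam_mu p = lam p + mu p"

text \<open>The embedding of \<open>A[\<nu>]\<close> into \<open>A[\<lambda>,\<mu>]\<close> with \<open>\<nu> \<mapsto> T\<close>.\<close>

definition at_var ::
    "('a poly poly \<Rightarrow> 'a poly poly) \<Rightarrow> 'a::ab_group_add poly \<Rightarrow> 'a poly poly" where
  "at_var T p = poly_subst T (\<lambda>x. [:[:x:]:]) p"

text \<open>
  Iterated products in \<open>A[\<lambda>,\<mu>]\<close>, where \<open>R\<close>, \<open>S\<close> are two of the operators above: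
  \<open>nest_right f R g S a b c\<close> is \<open>a f\<^sub>R (b g\<^sub>S c)\<close> and \<open>nest_left f R g S a b c\<close> is
  \<open>(a f\<^sub>R b) g\<^sub>S c\<close>. The outer product is extended linearly over the powers of the
  inner variable.
\<close>

definition nest_right ::
    "('a \<Rightarrow> 'a \<Rightarrow> 'a poly) \<Rightarrow> ('a poly poly \<Rightarrow> 'a poly poly)
      \<Rightarrow> ('a \<Rightarrow> 'a \<Rightarrow> 'a poly) \<Rightarrow> ('a poly poly \<Rightarrow> 'a poly poly)
      \<Rightarrow> 'a \<Rightarrow> 'a \<Rightarrow> 'a \<Rightarrow> 'a::ab_group_add poly poly" where
  "nest_right f R g S a b c = poly_subst S (\<lambda>y. at_var R (f a y)) (g b c)"

definition nest_left ::
    "('a \<Rightarrow> 'a \<Rightarrow> 'a poly) \<Rightarrow> ('a poly poly \<Rightarrow> 'a poly poly)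
      \<Rightarrow> ('a \<Rightarrow> 'a \<Rightarrow> 'a poly) \<Rightarrow> ('a poly poly \<Rightarrow> 'a poly poly)
      \<Rightarrow> 'a \<Rightarrow> 'a \<Rightarrow> 'a \<Rightarrow> 'a::ab_group_add poly poly" where
  "nest_left f R g S a b c = poly_subst R (\<lambda>x. at_var S (g x c)) (f a b)"

locale conformal_algebra =
  fixes f :: "'a::complex_del_module \<Rightarrow> 'a \<Rightarrow> 'a poly"
  assumes bilinear: "bilinear_map cscale (\<lambda>c. map_poly (cscale c)) f"
    and del_left: "f (del a) b = - pCons 0 (f a b)"
    and del_right: "f a (del b) = map_poly del (f a b) + pCons 0 (f a b)"

locale associative_conformal_algebra = conformal_algebra +
  assumes assoc: "nest_right f lam f mu a b c = nest_left f lam f lam_mu a b c"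

locale commutative_associative_conformal_algebra = associative_conformal_algebra +
  assumes commute: "f a b = poly_subst minus_lam_del (\<lambda>x. [:x:]) (f b a)"

locale lie_conformal_algebra = conformal_algebra +
  assumes skew: "f a b = - poly_subst minus_lam_del (\<lambda>x. [:x:]) (f b a)"
    and jacobi: "nest_right f lam f mu a b c
      = nest_left f lam f lam_mu a b c + nest_right f mu f lam b a c"

locale noncommutative_poisson_conformal_algebra =
  circ: associative_conformal_algebra circ + brac: lie_conformal_algebra brac
  for circ brac :: "'a::complex_del_module \<Rightarrow> 'a \<Rightarrow> 'a poly" +
  assumes leibniz: "nest_right brac lam circ mu a b c
    = nest_left brac lam circ lam_mu a b c + nest_right circ mu brac lam b a c"

locale poisson_conformal_algebra =
  noncommutative_poisson_conformal_algebra circ brac +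
  circ: commutative_associative_conformal_algebra circ
  for circ brac :: "'a::complex_del_module \<Rightarrow> 'a \<Rightarrow> 'a poly"

definition nth_product ::
    "('a::complex_del_module \<Rightarrow> 'a \<Rightarrow> 'a poly) \<Rightarrow> nat \<Rightarrow> 'a \<Rightarrow> 'a \<Rightarrow> 'a" where
  "nth_product f n a b = cscale (fact n) (coeff (f a b) n)"


section \<open>Poisson algebras\<close>

locale noncommutative_poisson_algebra = vector_space scale
  for scale :: "complex \<Rightarrow> 'v::ab_group_add \<Rightarrow> 'v" +
  fixes mult brac :: "'v \<Rightarrow> 'v \<Rightarrow> 'v"
  assumes mult_bilinear: "bilinear_map scale scale mult"
    and mult_assoc: "mult (mult x y) z = mult x (mult y z)"
    and brac_bilinear: "bilinear_map scale scale brac"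
    and brac_self: "brac x x = 0"
    and brac_jacobi: "brac x (brac y z) + brac y (brac z x) + brac z (brac x y) = 0"
    and leibniz: "brac x (mult y z) = mult (brac x y) z + mult y (brac x z)"

locale poisson_algebra = noncommutative_poisson_algebra +
  assumes mult_commute: "mult x y = mult y x"


section \<open>The coefficient space\<close>

text \<open>
  The vector space with basis the symbols \<open>a\<^sub>n\<close> is \<^typ>\<open>('a \<times> int) \<Rightarrow>\<^sub>0 complex\<close>, where
  \<open>a\<^sub>n\<close> is \<open>Poly_Mapping.single (a, n) 1\<close>.
\<close>

definition fscale :: "complex \<Rightarrow> ('k \<Rightarrow>\<^sub>0 complex) \<Rightarrow> ('k \<Rightarrow>\<^sub>0 complex)" where
  "fscale c = Poly_Mapping.map ((*) c)"

lemma lookup_fscale [simp]: "Poly_Mapping.lookup (fscale c x) k = c * Poly_Mapping.lookup x k"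
  by (auto simp: fscale_def map.rep_eq when_def)

interpretation free: vector_space "fscale :: complex \<Rightarrow> ('k \<Rightarrow>\<^sub>0 complex) \<Rightarrow> _"
  by unfold_locales (auto intro!: poly_mapping_eqI simp: lookup_add algebra_simps)

abbreviation basis_symbol :: "'a \<Rightarrow> int \<Rightarrow> ('a \<times> int) \<Rightarrow>\<^sub>0 complex" where
  "basis_symbol a n \<equiv> Poly_Mapping.single (a, n) 1"

definition coeff_relators :: "(('a::complex_del_module \<times> int) \<Rightarrow>\<^sub>0 complex) set" where
  "coeff_relators =
    {basis_symbol (cscale \<alpha> a) n - fscale \<alpha> (basis_symbol a n) | \<alpha> a n. True}
    \<union> {basis_symbol (a + b) n - basis_symbol a n - basis_symbol b n | a b n. True}
    \<union> {basis_symbol (del a) n + fscale (of_int n) (basis_symbol a (n - 1)) | a n. True}"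

definition coeff_rel ::
    "(('a::complex_del_module \<times> int) \<Rightarrow>\<^sub>0 complex) \<Rightarrow> (('a \<times> int) \<Rightarrow>\<^sub>0 complex) \<Rightarrow> bool" where
  "coeff_rel x y \<longleftrightarrow> x - y \<in> free.span coeff_relators"

lemma equivp_coeff_rel: "equivp coeff_rel"
proof (rule equivpI)
  show "reflp coeff_rel"
    by (auto simp: reflp_def coeff_rel_def free.span_zero)
  show "symp coeff_rel"
    unfolding symp_def coeff_rel_def by (auto dest: free.span_neg)
  show "transp coeff_rel"
    unfolding transp_def coeff_rel_def by (auto dest: free.span_add)
qed

quotient_type (overloaded) 'a coeff_space =
  "('a::complex_del_module \<times> int) \<Rightarrow>\<^sub>0 complex" / coeff_rel
  by (rule equivp_coeff_rel)

instantiation coeff_space :: (complex_del_module) ab_group_add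
begin

lift_definition zero_coeff_space :: "'a coeff_space" is 0 .

lift_definition plus_coeff_space :: "'a coeff_space \<Rightarrow> 'a coeff_space \<Rightarrow> 'a coeff_space" is "(+)"
  unfolding coeff_rel_def by (drule (1) free.span_add) (simp add: algebra_simps)

lift_definition uminus_coeff_space :: "'a coeff_space \<Rightarrow> 'a coeff_space" is uminus
  unfolding coeff_rel_def by (drule free.span_neg) (simp add: algebra_simps)

lift_definition minus_coeff_space :: "'a coeff_space \<Rightarrow> 'a coeff_space \<Rightarrow> 'a coeff_space" is "(-)"
  unfolding coeff_rel_def by (drule (1) free.span_diff) (simp add: algebra_simps)

instance
  by standard (transfer; simp add: coeff_rel_def free.span_zero algebra_simps)+

end

lift_definition coeff_scale :: "complex \<Rightarrow> 'a::complex_del_module coeff_space \<Rightarrow> 'a coeff_space"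
  is fscale
  unfolding coeff_rel_def by (simp add: free.span_scale free.scale_right_diff_distrib [symmetric])

lemma vector_space_coeff_scale:
  "vector_space (coeff_scale :: complex \<Rightarrow> 'a coeff_space \<Rightarrow> 'a::complex_del_module coeff_space)"
  by unfold_locales
    (transfer; simp add: coeff_rel_def free.span_zero free.scale_right_distrib
      free.scale_left_distrib)+

text \<open>The class of the symbol \<open>a\<^sub>n\<close>.\<close>

lift_definition coeff_symbol :: "'a::complex_del_module \<Rightarrow> int \<Rightarrow> 'a coeff_space"
  is basis_symbol .

text \<open>
  \<open>M\<close> is a bilinear operation on \<open>Coeff P\<close> with
  \<open>M a\<^sub>m b\<^sub>n = (\<Sum>j. (m choose j) (a\<^sub>(\<^sub>j\<^sub>) b)\<^bsub>m+n-j\<^esub>)\<close>. The sum has finite support because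
  \<open>f a b\<close> is a polynomial.
\<close>

definition is_coeff_operation ::
    "('a::complex_del_module \<Rightarrow> 'a \<Rightarrow> 'a poly)
      \<Rightarrow> ('a coeff_space \<Rightarrow> 'a coeff_space \<Rightarrow> 'a coeff_space) \<Rightarrow> bool" where
  "is_coeff_operation f M \<longleftrightarrow>
    bilinear_map coeff_scale coeff_scale M \<and>
    (\<forall>a b m n. M (coeff_symbol a m) (coeff_symbol b n) =
      Sum_any (\<lambda>j::nat. coeff_scale (of_int m gchoose j)
        (coeff_symbol (nth_product f j a b) (m + n - int j))))"

end

theory Submission
  imports Defs
begin

text \<open>
  Think of \<open>a\<^sub>m\<close> as \<open>a \<otimes> t\<^sup>m\<close>. The relation \<open>(\<partial>a)\<^sub>m = - m a\<^sub>m\<^sub>-\<^sub>1\<close> then says that \<open>\<partial>\<close> acts on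
  \<open>Coeff P\<close> as \<open>- d/dt\<close>, and, because \<open>j! (m choose j) t\<^bsup>m-j\<^esup>\<close> is the \<open>j\<close>-th derivative of \<open>t\<^sup>m\<close>,
  the product of \<open>a \<otimes> t\<^sup>m\<close> and \<open>b \<otimes> t\<^sup>n\<close> is obtained from \<open>a \<circ>\<^sub>\<lambda> b\<close> as follows: replace \<open>\<lambda>\<close> by
  \<open>d/ds\<close>, apply the operator to \<open>s\<^sup>m t\<^sup>n\<close>, and put \<open>s = t\<close>. This is a linear map
  \<open>eval2 m n : P[\<lambda>] \<rightarrow> Coeff P\<close>. In the same way \<open>eval3 l m n : P[\<lambda>,\<mu>] \<rightarrow> Coeff P\<close> lets \<open>\<lambda>\<close> and
  \<open>\<mu>\<close> differentiate the first two factors of a monomial in three variables which are identified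
  afterwards.

  These maps turn each conformal axiom into a property of \<open>Coeff P\<close>.

  \<^item> Sesquilinearity says that the formula for the product respects the relations of \<open>Coeff P\<close>,
  since \<open>- \<lambda>\<close> and \<open>\<partial> + \<lambda>\<close> become \<open>- d/ds\<close> and \<open>- d/dt\<close> (\<open>eval2_pCons\<close>, \<open>eval2_del\<close>). The universal
  property of \<open>Coeff P\<close>, in the bilinear form \<open>coeff_space_bilinear_universal\<close>, then yields the
  operation and its uniqueness.

  \<^item> The substitution \<open>\<lambda> \<mapsto> - \<lambda> - \<partial>\<close> becomes \<open>d/ds \<mapsto> d/dt\<close>, so it exchanges the two arguments
  (\<open>eval2_swap\<close>). Hence commutativity and skew-symmetry carry over.

  \<^item> By the product rule \<open>\<lambda> + \<mu>\<close> differentiates \<open>s\<^sup>l t\<^sup>m\<close> on the diagonal as \<open>t\<^bsup>l+m\<^esup>\<close>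
  (\<open>eval3_at_lam_mu\<close>). Therefore \<open>eval3\<close> maps the iterated \<open>\<lambda>\<close>-products of \<open>a, b, c\<close> to the
  iterated products of \<open>a\<^sub>l, b\<^sub>m, c\<^sub>n\<close>, and associativity, the Jacobi identity and the Leibniz rule
  on symbols follow by applying \<open>eval3\<close> to the conformal identities. Since symbols span,
  multilinearity does the rest.
\<close>

section \<open>Linear maps on the coefficient space\<close>

lemma coeff_symbol_add: "coeff_symbol (a + b) n = coeff_symbol a n + coeff_symbol b n"
proof (transfer, unfold coeff_rel_def)
  fix a b :: 'a and n :: int
  have "basis_symbol (a + b) n - basis_symbol a n - basis_symbol b n \<in> free.span coeff_relators"
    by (rule free.span_base) (unfold coeff_relators_def, blast)
  then show "basis_symbol (a + b) n - (basis_symbol a n + basis_symbol b n) \<in> free.span coeff_relators"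
    by (simp add: algebra_simps)
qed

lemma coeff_symbol_cscale: "coeff_symbol (cscale c a) n = coeff_scale c (coeff_symbol a n)"
  by (transfer, unfold coeff_rel_def, rule free.span_base) (unfold coeff_relators_def, blast)

lemma coeff_symbol_del:
  "coeff_symbol (del a) n = coeff_scale (- of_int n) (coeff_symbol a (n - 1))"
proof (transfer, unfold coeff_rel_def)
  fix a :: 'a and n :: int
  have "basis_symbol (del a) n + fscale (of_int n) (basis_symbol a (n - 1)) \<in> free.span coeff_relators"
    by (rule free.span_base) (unfold coeff_relators_def, blast)
  then show "basis_symbol (del a) n - fscale (- of_int n) (basis_symbol a (n - 1)) \<in> free.span coeff_relators"
    by (simp add: free.scale_minus_left)
qed

interpretation coeff: vector_space coeff_scale
  by (rule vector_space_coeff_scale)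

lemma coeff_symbol_zero [simp]: "coeff_symbol 0 n = 0"
  using coeff_symbol_add[of 0 0 n] by simp

lemma coeff_space_induct [case_names symbol scale add]:
  assumes symbol: "\<And>a n. P (coeff_symbol a n)"
    and scale: "\<And>c x. P x \<Longrightarrow> P (coeff_scale c x)"
    and add: "\<And>x y. P x \<Longrightarrow> P y \<Longrightarrow> P (x + y)"
  shows "P x"
proof -
  have *: "P (abs_coeff_space u)" for u
  proof (induction u rule: update_induct)
    case const
    have "P 0" using scale[OF symbol, of 0] by simp
    then show ?case by (simp add: zero_coeff_space_def)
  next
    case (update u k c)
    obtain a n where k: "k = (a, n)" by (cases k)
    have eq: "Poly_Mapping.update k c u = u + fscale c (basis_symbol a n)"
      using update(1) k
      by (intro poly_mapping_eqI) (auto simp: lookup_add lookup_update lookup_single in_keys_iff when_def)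
    have "abs_coeff_space (Poly_Mapping.update k c u)
        = abs_coeff_space u + coeff_scale c (coeff_symbol a n)"
      unfolding eq plus_coeff_space.abs_eq[symmetric] coeff_scale.abs_eq[symmetric] coeff_symbol.abs_eq ..
    then show ?case using add[OF update(3) scale[OF symbol]] by simp
  qed
  show ?thesis by (induct x rule: coeff_space.abs_induct) (rule *)
qed

definition free_lift :: "(complex \<Rightarrow> 'v::ab_group_add \<Rightarrow> 'v) \<Rightarrow> ('k \<Rightarrow> 'v) \<Rightarrow> ('k \<Rightarrow>\<^sub>0 complex) \<Rightarrow> 'v" where
  "free_lift s \<phi> u = (\<Sum>k\<in>Poly_Mapping.keys u. s (Poly_Mapping.lookup u k) (\<phi> k))"

lemma linear_free_lift:
  assumes "vector_space s"
  shows "Vector_Spaces.linear fscale s (free_lift s \<phi>)"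
proof -
  interpret V: vector_space s by fact
  have superset: "free_lift s \<phi> u = (\<Sum>k\<in>A. s (Poly_Mapping.lookup u k) (\<phi> k))"
    if "finite A" "Poly_Mapping.keys u \<subseteq> A" for A u
    unfolding free_lift_def using that
    by (intro sum.mono_neutral_left) (auto simp: in_keys_iff)
  show ?thesis
  proof (unfold Vector_Spaces.linear_iff, intro conjI allI)
    fix u v :: "'b \<Rightarrow>\<^sub>0 complex"
    let ?A = "Poly_Mapping.keys u \<union> Poly_Mapping.keys v"
    show "free_lift s \<phi> (u + v) = free_lift s \<phi> u + free_lift s \<phi> v"
      using Poly_Mapping.keys_add[of u v]
      by (simp add: superset[of ?A] lookup_add V.scale_left_distrib sum.distrib)
  next
    fix c and u :: "'b \<Rightarrow>\<^sub>0 complex"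
    show "free_lift s \<phi> (fscale c u) = s c (free_lift s \<phi> u)"
      by (subst (1 2) superset[of "Poly_Mapping.keys u"])
        (auto simp: in_keys_iff V.scale_sum_right)
  qed (unfold_locales)
qed

lemma free_lift_single:
  assumes "vector_space s"
  shows "free_lift s \<phi> (Poly_Mapping.single k 1) = \<phi> k"
proof -
  interpret V: vector_space s by fact
  show ?thesis by (simp add: free_lift_def)
qed

text \<open>
  The map induced on the quotient by the linear extension of \<open>\<phi>\<close> to the free space: the
  conditions on \<open>\<phi>\<close> say exactly that this extension kills the three families of relators.
\<close>

lemma coeff_space_universal:
  fixes \<phi> :: "'a::complex_del_module \<Rightarrow> int \<Rightarrow> 'v::ab_group_add"
  assumes s: "vector_space s"
    and add: "\<And>a b n. \<phi> (a + b) n = \<phi> a n + \<phi> b n"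
    and scale: "\<And>c a n. \<phi> (cscale c a) n = s c (\<phi> a n)"
    and del: "\<And>a n. \<phi> (del a) n = s (- of_int n) (\<phi> a (n - 1))"
  obtains L where "Vector_Spaces.linear coeff_scale s L" "\<And>a n. L (coeff_symbol a n) = \<phi> a n"
proof -
  interpret V: vector_space s by fact
  define F where "F = free_lift s (\<lambda>(a, n). \<phi> a n)"
  interpret F: Vector_Spaces.linear fscale s F
    unfolding F_def by (rule linear_free_lift[OF s])
  have symbol: "F (basis_symbol a n) = \<phi> a n" for a n
    by (simp add: F_def free_lift_single[OF s])
  have relators: "F u = 0" if "u \<in> coeff_relators" for u
    using that unfolding coeff_relators_def
    by (auto simp: F.diff F.add F.scale symbol add scale del)
  have cong: "F u = F v" if "coeff_rel u v" for u v
  proof -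
    have "F (u - v) = 0"
      using relators that[unfolded coeff_rel_def] by (rule F.eq_0_on_span)
    then show ?thesis by (simp add: F.diff)
  qed
  define L where "L x = F (rep_coeff_space x)" for x
  have L: "L (abs_coeff_space u) = F u" for u
    unfolding L_def
    by (rule cong, rule Quotient3_rep_abs[OF Quotient3_coeff_space],
        rule equivp_reflp[OF equivp_coeff_rel])
  show thesis
  proof (rule that)
    show "L (coeff_symbol a n) = \<phi> a n" for a n
      by (simp add: coeff_symbol.abs_eq L symbol)
    show "Vector_Spaces.linear coeff_scale s L"
    proof (unfold Vector_Spaces.linear_iff, intro conjI allI)
      show "L (x + y) = L x + L y" for x y
        by (induct x rule: coeff_space.abs_induct, induct y rule: coeff_space.abs_induct)
          (simp add: plus_coeff_space.abs_eq L F.add)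
      show "L (coeff_scale c x) = s c (L x)" for c x
        by (induct x rule: coeff_space.abs_induct) (simp add: coeff_scale.abs_eq L F.scale)
    qed (fact s vector_space_coeff_scale)+
  qed
qed

lemma linear_coeff_space_eqI:
  assumes "Vector_Spaces.linear coeff_scale s L" "Vector_Spaces.linear coeff_scale s L'"
    and "\<And>a n. L (coeff_symbol a n) = L' (coeff_symbol a n)"
  shows "L x = L' x"
  using assms(1,2) by (induct x rule: coeff_space_induct) (simp_all add: assms(3) Vector_Spaces.linear_iff)

lemma bilinear_map_iff:
  assumes "vector_space s" "vector_space t"
  shows "bilinear_map s t f \<longleftrightarrow>
    (\<forall>x x' y. f (x + x') y = f x y + f x' y) \<and> (\<forall>x y y'. f x (y + y') = f x y + f x y') \<and>
    (\<forall>c x y. f (s c x) y = t c (f x y)) \<and> (\<forall>c x y. f x (s c y) = t c (f x y))"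
  using assms unfolding bilinear_map_def Vector_Spaces.linear_iff by auto

lemmas coeff_bilinear_map_iff =
  bilinear_map_iff[OF vector_space_coeff_scale vector_space_coeff_scale]

text \<open>
  Two applications of the universal property, one per argument. For fixed \<open>a\<close>, \<open>m\<close> the function
  \<open>\<phi> a m\<close> extends to a linear map \<open>K a m\<close>; for fixed \<open>y\<close> the function \<open>K a m y\<close> of \<open>a\<close>, \<open>m\<close>
  satisfies the relations again, because it does so when \<open>y\<close> is a symbol and both sides are linear
  in \<open>y\<close>. The same argument shows that the result is linear in \<open>y\<close>.
\<close>

lemma coeff_space_bilinear_universal:
  fixes \<phi> :: "'a::complex_del_module \<Rightarrow> int \<Rightarrow> 'a \<Rightarrow> int \<Rightarrow> 'a coeff_space"
  assumes add_left: "\<And>a a' m b n. \<phi> (a + a') m b n = \<phi> a m b n + \<phi> a' m b n"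
    and scale_left: "\<And>c a m b n. \<phi> (cscale c a) m b n = coeff_scale c (\<phi> a m b n)"
    and del_left: "\<And>a m b n. \<phi> (del a) m b n = coeff_scale (- of_int m) (\<phi> a (m - 1) b n)"
    and add_right: "\<And>a m b b' n. \<phi> a m (b + b') n = \<phi> a m b n + \<phi> a m b' n"
    and scale_right: "\<And>c a m b n. \<phi> a m (cscale c b) n = coeff_scale c (\<phi> a m b n)"
    and del_right: "\<And>a m b n. \<phi> a m (del b) n = coeff_scale (- of_int n) (\<phi> a m b (n - 1))"
  shows "\<exists>!M. bilinear_map coeff_scale coeff_scale M \<and>
    (\<forall>a b m n. M (coeff_symbol a m) (coeff_symbol b n) = \<phi> a m b n)"
proof (rule ex_ex1I)
  have "\<exists>L. Vector_Spaces.linear coeff_scale coeff_scale L \<and>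
      (\<forall>b n. L (coeff_symbol b n) = \<phi> a m b n)" for a m
    by (rule coeff_space_universal[OF vector_space_coeff_scale, of "\<phi> a m"])
      (auto simp: add_right scale_right del_right)
  then obtain K where K: "\<And>a m. Vector_Spaces.linear coeff_scale coeff_scale (K a m)"
    and K_symbol: "\<And>a m b n. K a m (coeff_symbol b n) = \<phi> a m b n"
    by metis
  have K_add: "K a m (x + y) = K a m x + K a m y"
    and K_scale: "K a m (coeff_scale c x) = coeff_scale c (K a m x)"
    for a m x y c using K unfolding Vector_Spaces.linear_iff by blast+
  have "K (a + a') m y = K a m y + K a' m y" for a a' m y
    by (induct y rule: coeff_space_induct)
      (simp_all add: K_symbol K_add K_scale add_left coeff.scale_right_distrib)
  moreover have "K (cscale c a) m y = coeff_scale c (K a m y)" for c a m y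
    by (induct y rule: coeff_space_induct)
      (simp_all add: K_symbol K_add K_scale scale_left coeff.scale_right_distrib mult.commute)
  moreover have "K (del a) m y = coeff_scale (- of_int m) (K a (m - 1) y)" for a m y
    by (induct y rule: coeff_space_induct)
      (simp_all add: K_symbol K_add K_scale del_left coeff.scale_right_distrib mult.commute)
  ultimately have "\<exists>L. Vector_Spaces.linear coeff_scale coeff_scale L \<and>
      (\<forall>a m. L (coeff_symbol a m) = K a m y)" for y
    by (rule coeff_space_universal[OF vector_space_coeff_scale, of "\<lambda>a m. K a m y"]) blast+
  then obtain L where L: "\<And>y. Vector_Spaces.linear coeff_scale coeff_scale (L y)"
    and L_symbol: "\<And>y a m. L y (coeff_symbol a m) = K a m y"
    by metis
  have L_add: "L y (x + x') = L y x + L y x'"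
    and L_scale: "L y (coeff_scale c x) = coeff_scale c (L y x)"
    for y x x' c using L unfolding Vector_Spaces.linear_iff by blast+
  have L_add': "L (y + y') x = L y x + L y' x" for x y y'
    by (induct x rule: coeff_space_induct)
      (simp_all add: L_symbol L_add L_scale K_add coeff.scale_right_distrib)
  have L_scale': "L (coeff_scale c y) x = coeff_scale c (L y x)" for c x y
    by (induct x rule: coeff_space_induct)
      (simp_all add: L_symbol L_add L_scale K_scale coeff.scale_right_distrib mult.commute)
  show "\<exists>M. bilinear_map coeff_scale coeff_scale M \<and>
      (\<forall>a b m n. M (coeff_symbol a m) (coeff_symbol b n) = \<phi> a m b n)"
    by (rule exI[of _ "\<lambda>x y. L y x"])
      (simp add: coeff_bilinear_map_iff L_add L_scale L_add' L_scale' L_symbol K_symbol)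
next
  fix M N
  assume M: "bilinear_map coeff_scale coeff_scale M \<and>
      (\<forall>a b m n. M (coeff_symbol a m) (coeff_symbol b n) = \<phi> a m b n)"
    and N: "bilinear_map coeff_scale coeff_scale N \<and>
      (\<forall>a b m n. N (coeff_symbol a m) (coeff_symbol b n) = \<phi> a m b n)"
  have M_lin: "Vector_Spaces.linear coeff_scale coeff_scale (M x)"
      "Vector_Spaces.linear coeff_scale coeff_scale (\<lambda>x. M x y)"
    and N_lin: "Vector_Spaces.linear coeff_scale coeff_scale (N x)"
      "Vector_Spaces.linear coeff_scale coeff_scale (\<lambda>x. N x y)" for x y
    using M N unfolding bilinear_map_def by blast+
  have "M (coeff_symbol a m) y = N (coeff_symbol a m) y" for a m y
    by (rule linear_coeff_space_eqI[OF M_lin(1) N_lin(1)]) (simp add: M N)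
  then have "M x y = N x y" for x y
    by (rule linear_coeff_space_eqI[OF M_lin(2) N_lin(2)])
  then show "M = N" by (intro ext)
qed


section \<open>Evaluating polynomials on monomials\<close>

text \<open>
  The coefficient in \<open>(d/dt)\<^sup>k t\<^sup>m = falling m k t\<^bsup>m-k\<^esup>\<close>. The two recursions below differentiate once
  before, respectively after, the other \<open>k\<close> derivatives.
\<close>

definition falling :: "int \<Rightarrow> nat \<Rightarrow> complex" where
  "falling m k = fact k * (of_int m gchoose k)"

lemma falling_0 [simp]: "falling m 0 = 1"
  by (simp add: falling_def)

lemma falling_Suc: "falling m (Suc k) = of_int m * falling (m - 1) k"
proof -
  have "falling m (Suc k) = fact k * (of_nat (Suc k) * (of_int m gchoose Suc k))"
    by (simp only: falling_def fact_Suc of_nat_mult mult_ac)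
  then show ?thesis
    by (simp only: gbinomial_absorption) (simp add: falling_def)
qed

lemma falling_Suc': "falling m (Suc k) = (of_int m - of_nat k) * falling m k"
proof -
  have "falling m (Suc k) = fact k * (of_int m * ((of_int m - 1) gchoose k))"
    by (simp add: falling_Suc) (simp add: falling_def)
  then show ?thesis
    by (simp only: flip: gbinomial_absorb_comp) (simp add: falling_def)
qed

text \<open>
  Summation over the coefficients of a polynomial, with an arbitrary term \<open>h k p\<^sub>k\<close>. The evaluation
  maps and \<^const>\<open>poly_subst\<close> are all of this form, which lets them be composed termwise.
\<close>

definition coeff_sum :: "(nat \<Rightarrow> 'a::zero \<Rightarrow> 'b::comm_monoid_add) \<Rightarrow> 'a poly \<Rightarrow> 'b" where
  "coeff_sum h p = (\<Sum>k\<le>degree p. h k (coeff p k))"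

lemma coeff_sum_bound:
  assumes "\<And>k. h k 0 = 0" "degree p \<le> N"
  shows "coeff_sum h p = (\<Sum>k\<le>N. h k (coeff p k))"
  unfolding coeff_sum_def using assms
  by (intro sum.mono_neutral_left) (auto simp: coeff_eq_0)

lemma coeff_sum_0: "(\<And>k. h k 0 = 0) \<Longrightarrow> coeff_sum h 0 = 0"
  by (simp add: coeff_sum_def)

lemma coeff_sum_pCons:
  assumes "\<And>k. h k 0 = 0"
  shows "coeff_sum h (pCons a p) = h 0 a + coeff_sum (\<lambda>k. h (Suc k)) p"
  using assms by (subst coeff_sum_bound[where N = "Suc (degree p)"])
    (simp_all add: degree_pCons_le coeff_sum_def sum.atMost_Suc_shift del: sum.atMost_Suc)

lemma coeff_sum_add:
  assumes "\<And>k. h k 0 = 0" "\<And>k x y. h k (x + y) = h k x + h k y"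
  shows "coeff_sum h (p + q) = coeff_sum h p + coeff_sum h q"
  using assms
  by (simp add: coeff_sum_bound[where N = "max (degree p) (degree q)"] degree_add_le_max sum.distrib)

lemma coeff_sum_map_poly:
  assumes "\<And>k. h k 0 = 0" "g 0 = 0"
  shows "coeff_sum h (map_poly g p) = coeff_sum (\<lambda>k x. h k (g x)) p"
proof -
  have "degree (map_poly g p) \<le> degree p"
    using assms(2) by (intro degree_le) (simp add: coeff_map_poly coeff_eq_0)
  then show ?thesis
    using assms by (simp add: coeff_sum_bound[where N = "degree p"] coeff_map_poly)
qed

lemma coeff_sum_hom:
  assumes "\<And>x y. L (x + y) = L x + L y" "L 0 = 0"
  shows "L (coeff_sum h p) = coeff_sum (\<lambda>k x. L (h k x)) p"
  unfolding coeff_sum_def 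
  using sum_comp_morphism[of L "\<lambda>k. h k (coeff p k)" "{..degree p}", OF assms(2,1)]
  by (simp add: o_def)

lemma poly_subst_coeff_sum: "poly_subst T \<iota> p = coeff_sum (\<lambda>k x. (T ^^ k) (\<iota> x)) p"
  by (simp add: poly_subst_def coeff_sum_def)

text \<open>
  The value of \<open>p(d/ds)\<close> at \<open>s\<^sup>m t\<^sup>n\<close>, restricted to \<open>s = t\<close>, where \<open>x t\<^sup>i\<close> stands for \<open>x\<^sub>i\<close>.
\<close>

definition eval2 :: "int \<Rightarrow> int \<Rightarrow> 'a::complex_del_module poly \<Rightarrow> 'a coeff_space" where
  "eval2 m n = coeff_sum (\<lambda>k x. coeff_scale (falling m k) (coeff_symbol x (m + n - int k)))"

lemma del_add: "del (x + y) = del x + del y"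
  by (simp add: del_def pscale_right_distrib)

lemma del_0 [simp]: "del 0 = 0"
  using del_add[of 0 0] by simp

interpretation cscale: vector_space "cscale :: complex \<Rightarrow> 'a \<Rightarrow> 'a::complex_del_module"
  by (rule vector_space_cscale)

lemma eval2_0 [simp]: "eval2 m n 0 = 0"
  by (simp add: eval2_def coeff_sum_0)

lemma eval2_add: "eval2 m n (p + q) = eval2 m n p + eval2 m n q"
  unfolding eval2_def
  by (rule coeff_sum_add) (simp_all add: coeff_symbol_add coeff.scale_right_distrib)

lemma eval2_uminus: "eval2 m n (- p) = - eval2 m n p"
  using eval2_add[of m n "- p" p] by (simp add: eq_neg_iff_add_eq_0)

lemma eval2_cscale: "eval2 m n (map_poly (cscale c) p) = coeff_scale c (eval2 m n p)"
  unfolding eval2_def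
  by (simp add: coeff_sum_map_poly)
    (simp add: coeff_sum_def coeff_symbol_cscale coeff.scale_sum_right mult.commute)

lemma eval2_pCons:
  "eval2 m n (pCons a p) = coeff_symbol a (m + n) + coeff_scale (of_int m) (eval2 (m - 1) n p)"
  unfolding eval2_def
  by (simp add: coeff_sum_pCons)
    (simp add: coeff_sum_def falling_Suc coeff.scale_sum_right algebra_simps)

text \<open>
  Differentiating \<open>s\<^sup>m t\<^sup>n\<close> on the diagonal is \<open>d/ds + d/dt\<close>, and \<open>\<partial>\<close> acts on symbols as minus the
  derivative. So \<open>\<partial> + \<lambda>\<close> acts as \<open>- d/dt\<close>.
\<close>

lemma eval2_del:
  "eval2 m n (map_poly del p + pCons 0 p) = coeff_scale (- of_int n) (eval2 m (n - 1) p)"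
proof -
  have "eval2 m n (pCons 0 p) = coeff_sum (\<lambda>k x. coeff_scale (falling m (Suc k))
      (coeff_symbol x (m + n - int (Suc k)))) p"
    unfolding eval2_def by (simp add: coeff_sum_pCons)
  moreover have "eval2 m n (map_poly del p) = coeff_sum (\<lambda>k x. coeff_scale
      (falling m k * (of_nat k - of_int m - of_int n)) (coeff_symbol x (m + n - int (Suc k)))) p"
    unfolding eval2_def by (simp add: coeff_sum_map_poly)
      (simp add: coeff_symbol_del algebra_simps)
  ultimately show ?thesis
    unfolding eval2_add
    by (simp add: eval2_def coeff_sum_def sum.distrib[symmetric]
      coeff.scale_left_distrib[symmetric] falling_Suc' coeff.scale_sum_right
      flip: sum_negf coeff.scale_minus_left)
      (simp add: algebra_simps)
qed

lemma eval2_minus_lam_del: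
  "eval2 m n (minus_lam_del p) = coeff_scale (of_int n) (eval2 m (n - 1) p)"
proof -
  have "minus_lam_del p = - (map_poly del p + pCons 0 p)"
    by (simp add: minus_lam_del_def)
  then show ?thesis by (simp only: eval2_uminus eval2_del) simp
qed

text \<open>
  By the preceding lemma powers of \<open>- \<lambda> - \<partial>\<close> act as powers of \<open>d/dt\<close>, so the substitution turns
  \<open>p(d/ds)\<close> into \<open>p(d/dt)\<close>.
\<close>

lemma eval2_swap: "eval2 m n (poly_subst minus_lam_del (\<lambda>x. [:x:]) p) = eval2 n m p"
proof -
  have "eval2 m n ((minus_lam_del ^^ k) [:x:])
      = coeff_scale (falling n k) (coeff_symbol x (m + n - int k))" for k n and x :: 'a
    by (induct k arbitrary: n)
      (simp_all add: eval2_pCons eval2_minus_lam_del falling_Suc algebra_simps)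
  then show ?thesis
    unfolding poly_subst_coeff_sum
    by (subst coeff_sum_hom[of "eval2 m n"]) (simp_all add: eval2_add eval2_def[of n m] add.commute)
qed

text \<open>
  The value of \<open>q(d/dr, d/ds)\<close> at \<open>r\<^sup>l s\<^sup>m t\<^sup>n\<close>, restricted to \<open>r = s = t\<close>, for \<open>q \<in> P[\<lambda>,\<mu>]\<close>. The outer
  variable \<open>\<mu>\<close> is summed here; for the inner one \<open>\<lambda>\<close>, the already differentiated \<open>s\<^bsup>m-j\<^esup>\<close> and
  \<open>t\<^sup>n\<close> can be merged into one monomial.
\<close>

definition eval3 :: "int \<Rightarrow> int \<Rightarrow> int \<Rightarrow> 'a::complex_del_module poly poly \<Rightarrow> 'a coeff_space" where
  "eval3 l m n = coeff_sum (\<lambda>j p. coeff_scale (falling m j) (eval2 l (m + n - int j) p))"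

lemma eval3_0 [simp]: "eval3 l m n 0 = 0"
  by (simp add: eval3_def coeff_sum_0)

lemma eval3_add: "eval3 l m n (p + q) = eval3 l m n p + eval3 l m n q"
  unfolding eval3_def
  by (rule coeff_sum_add) (simp_all add: eval2_add coeff.scale_right_distrib)

lemma eval3_const: "eval3 l m n [:[:x:]:] = coeff_symbol x (l + m + n)"
  by (simp add: eval3_def coeff_sum_pCons coeff_sum_0 eval2_pCons algebra_simps)

lemma eval3_lam: "eval3 l m n (lam q) = coeff_scale (of_int l) (eval3 (l - 1) m n q)"
  unfolding eval3_def lam_def
  by (simp add: coeff_sum_map_poly)
    (simp add: coeff_sum_def eval2_pCons coeff.scale_sum_right mult.commute)

lemma eval3_mu: "eval3 l m n (mu q) = coeff_scale (of_int m) (eval3 l (m - 1) n q)"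
  unfolding eval3_def mu_def
  by (simp add: coeff_sum_pCons)
    (simp add: coeff_sum_def falling_Suc coeff.scale_sum_right algebra_simps)

lemma eval3_lam_pow: "eval3 l m n ((lam ^^ k) q) = coeff_scale (falling l k) (eval3 (l - int k) m n q)"
  by (induct k arbitrary: l) (simp_all add: eval3_lam falling_Suc algebra_simps)

lemma eval3_mu_pow: "eval3 l m n ((mu ^^ k) q) = coeff_scale (falling m k) (eval3 l (m - int k) n q)"
  by (induct k arbitrary: m) (simp_all add: eval3_mu falling_Suc algebra_simps)

text \<open>
  The product rule: each \<open>\<lambda> + \<mu>\<close> contributes the sum of the exponents \<open>l\<close> and \<open>m\<close> and lowers one
  of them by one, and both resulting monomials agree on the diagonal.
\<close>

lemma eval3_lam_mu_pow:
  "eval3 l m n ((lam_mu ^^ k) [:[:x:]:])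
    = coeff_scale (falling (l + m) k) (coeff_symbol x (l + m + n - int k))"
proof (induct k arbitrary: l m)
  case (Suc k)
  show ?case
    by (simp add: lam_mu_def[of "(lam_mu ^^ k) _"] eval3_add eval3_lam eval3_mu Suc falling_Suc
        algebra_simps)
qed (simp add: eval3_const)

lemma eval3_poly_subst:
  "eval3 l m n (poly_subst T \<iota> p) = coeff_sum (\<lambda>k x. eval3 l m n ((T ^^ k) (\<iota> x))) p"
  unfolding poly_subst_coeff_sum by (rule coeff_sum_hom) (simp_all add: eval3_add)

text \<open>
  A polynomial placed in one variable only differentiates the corresponding factor; the other two
  factors merge. Placed in \<open>\<lambda> + \<mu>\<close> it differentiates the product of the first two.
\<close>

lemma eval3_at_lam: "eval3 l m n (at_var lam p) = eval2 l (m + n) p"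
  unfolding at_var_def eval3_poly_subst
  by (simp add: eval3_lam_pow eval3_const eval2_def algebra_simps)

lemma eval3_at_mu: "eval3 l m n (at_var mu p) = eval2 m (l + n) p"
  unfolding at_var_def eval3_poly_subst
  by (simp add: eval3_mu_pow eval3_const eval2_def algebra_simps)

lemma eval3_at_lam_mu: "eval3 l m n (at_var lam_mu p) = eval2 (l + m) n p"
  unfolding at_var_def eval3_poly_subst
  by (simp add: eval3_lam_mu_pow eval2_def)


section \<open>Products on the coefficient space\<close>

text \<open>
  The defining formula in terms of \<^const>\<open>eval2\<close>: the factor \<open>j!\<close> of the \<open>j\<close>-th product turns
  \<open>m choose j\<close> into the falling factorial.
\<close>

lemma is_coeff_operation_iff:
  "is_coeff_operation f M \<longleftrightarrow> bilinear_map coeff_scale coeff_scale M \<and>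
    (\<forall>a b m n. M (coeff_symbol a m) (coeff_symbol b n) = eval2 m n (f a b))"
proof -
  have "Sum_any (\<lambda>j::nat. coeff_scale (of_int m gchoose j)
        (coeff_symbol (nth_product f j a b) (m + n - int j))) = eval2 m n (f a b)" for m n a b
    by (subst Sum_any.expand_superset[of "{..degree (f a b)}"])
      (auto simp: nth_product_def eval2_def coeff_sum_def coeff_symbol_cscale falling_def
        mult.commute intro: le_degree)
  then show ?thesis by (simp add: is_coeff_operation_def)
qed

lemma (in conformal_algebra) ex1_coeff_operation: "\<exists>!M. is_coeff_operation f M"
proof -
  have "vector_space (\<lambda>c. map_poly (cscale c) :: 'a poly \<Rightarrow> _)"
    using bilinear by (simp add: bilinear_map_def Vector_Spaces.linear_iff)
  then have f: "f (x + x') y = f x y + f x' y" "f x (y + y') = f x y + f x y'"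
    "f (cscale c x) y = map_poly (cscale c) (f x y)" "f x (cscale c y) = map_poly (cscale c) (f x y)"
    for x x' y y' c
    using bilinear by (simp_all add: bilinear_map_iff[OF vector_space_cscale])
  have left: "eval2 m n (f (del a) b) = coeff_scale (- of_int m) (eval2 (m - 1) n (f a b))" for a b m n
    by (simp add: del_left eval2_uminus eval2_pCons)
  have right: "eval2 m n (f a (del b)) = coeff_scale (- of_int n) (eval2 m (n - 1) (f a b))" for a b m n
    by (simp only: del_right eval2_del)
  show ?thesis
    unfolding is_coeff_operation_iff
    by (rule coeff_space_bilinear_universal) (simp_all only: f left right eval2_add eval2_cscale)
qed

lemma bilinear_map_coeff_sum:
  assumes "bilinear_map coeff_scale coeff_scale M"
  shows "M x (coeff_sum (\<lambda>k a. coeff_scale (c k) (h k a)) p)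
      = coeff_sum (\<lambda>k a. coeff_scale (c k) (M x (h k a))) p"
    and "M (coeff_sum (\<lambda>k a. coeff_scale (c k) (h k a)) p) x
      = coeff_sum (\<lambda>k a. coeff_scale (c k) (M (h k a) x)) p"
proof -
  have *: "M x (y + y') = M x y + M x y'" "M (y + y') x = M y x + M y' x"
    "M x (coeff_scale c y) = coeff_scale c (M x y)" "M (coeff_scale c y) x = coeff_scale c (M y x)" for x y y' c
    using assms by (simp_all add: coeff_bilinear_map_iff)
  have z: "M x 0 = 0" "M 0 x = 0" using *(1)[of x 0 0] *(2)[of 0 0 x] by simp_all
  show "M x (coeff_sum (\<lambda>k a. coeff_scale (c k) (h k a)) p)
      = coeff_sum (\<lambda>k a. coeff_scale (c k) (M x (h k a))) p"
    by (subst coeff_sum_hom[of "M x"]) (simp_all add: * z)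
  show "M (coeff_sum (\<lambda>k a. coeff_scale (c k) (h k a)) p) x
      = coeff_sum (\<lambda>k a. coeff_scale (c k) (M (h k a) x)) p"
    by (subst coeff_sum_hom[of "\<lambda>y. M y x"]) (simp_all add: * z)
qed

text \<open>
  Iterated products of symbols are images under \<^const>\<open>eval3\<close> of iterated \<open>\<lambda>\<close>-products. In each
  case the inner product contributes the powers of its own variable, which shift one exponent, and
  the outer product is then evaluated at the shifted exponents. The swapped form exchanges
  the roles of \<open>\<lambda>\<close> and \<open>\<mu>\<close>, so that all terms of the Leibniz rule are evaluated at the same
  monomial.
\<close>

context
  fixes f g :: "'a::complex_del_module \<Rightarrow> 'a \<Rightarrow> 'a poly" and M N
  assumes f: "is_coeff_operation f M" and g: "is_coeff_operation g N"
begin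

private lemma symbol:
  "M (coeff_symbol a m) (coeff_symbol b n) = eval2 m n (f a b)"
  "N (coeff_symbol a m) (coeff_symbol b n) = eval2 m n (g a b)"
  using f g by (simp_all add: is_coeff_operation_iff)

private lemma M_eval2: "M x (eval2 m n p)
    = coeff_sum (\<lambda>k a. coeff_scale (falling m k) (M x (coeff_symbol a (m + n - int k)))) p"
  unfolding eval2_def
  by (rule bilinear_map_coeff_sum(1)[of M]) (use f in \<open>simp add: is_coeff_operation_def\<close>)

private lemma N_eval2: "N (eval2 m n p) x
    = coeff_sum (\<lambda>k a. coeff_scale (falling m k) (N (coeff_symbol a (m + n - int k)) x)) p"
  unfolding eval2_def
  by (rule bilinear_map_coeff_sum(2)[of N]) (use g in \<open>simp add: is_coeff_operation_def\<close>)

lemma eval3_nest_right: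
  "M (coeff_symbol a l) (N (coeff_symbol b m) (coeff_symbol c n))
    = eval3 l m n (nest_right f lam g mu a b c)"
  by (simp add: nest_right_def eval3_poly_subst symbol M_eval2 eval3_mu_pow eval3_at_lam algebra_simps)

lemma eval3_nest_right_swapped:
  "M (coeff_symbol b m) (N (coeff_symbol a l) (coeff_symbol c n))
    = eval3 l m n (nest_right f mu g lam b a c)"
  by (simp add: nest_right_def eval3_poly_subst symbol M_eval2 eval3_lam_pow eval3_at_mu algebra_simps)

lemma eval3_nest_left:
  "N (M (coeff_symbol a l) (coeff_symbol b m)) (coeff_symbol c n)
    = eval3 l m n (nest_left f lam g lam_mu a b c)"
  by (simp add: nest_left_def eval3_poly_subst symbol N_eval2 eval3_lam_pow eval3_at_lam_mu algebra_simps)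

end

lemma is_coeff_operation_linear:
  assumes "is_coeff_operation f M"
  shows "M (x + x') y = M x y + M x' y" "M x (y + y') = M x y + M x y'"
    "M (coeff_scale c x) y = coeff_scale c (M x y)" "M x (coeff_scale c y) = coeff_scale c (M x y)"
  using assms by (simp_all add: is_coeff_operation_def coeff_bilinear_map_iff)

lemma (in associative_conformal_algebra) coeff_operation_assoc:
  assumes M: "is_coeff_operation f M"
  shows "M (M x y) z = M x (M y z)"
proof -
  note lin = is_coeff_operation_linear[OF M]
  \<comment> \<open>The identity on symbols is extended by linearity to one argument after the other.\<close>
  have "M (M (coeff_symbol a l) (coeff_symbol b m)) (coeff_symbol c n)
      = M (coeff_symbol a l) (M (coeff_symbol b m) (coeff_symbol c n))" for a b c l m n
    by (simp add: eval3_nest_left[OF M M] eval3_nest_right[OF M M] assoc)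
  then have "M (M (coeff_symbol a l) (coeff_symbol b m)) z
      = M (coeff_symbol a l) (M (coeff_symbol b m) z)" for a b l m
    by (induct z rule: coeff_space_induct) (simp_all add: lin)
  then have "M (M (coeff_symbol a l) y) z = M (coeff_symbol a l) (M y z)" for a l
    by (induct y rule: coeff_space_induct) (simp_all add: lin)
  then show ?thesis
    by (induct x rule: coeff_space_induct) (simp_all add: lin)
qed

lemma (in commutative_associative_conformal_algebra) coeff_operation_commute:
  assumes M: "is_coeff_operation f M"
  shows "M x y = M y x"
proof -
  note lin = is_coeff_operation_linear[OF M]
  have "M (coeff_symbol a m) (coeff_symbol b n) = M (coeff_symbol b n) (coeff_symbol a m)" for a b m n
    using M unfolding is_coeff_operation_iff by (metis commute eval2_swap)
  then have "M (coeff_symbol a m) y = M y (coeff_symbol a m)" for a m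
    by (induct y rule: coeff_space_induct) (simp_all add: lin)
  then show ?thesis
    by (induct x rule: coeff_space_induct) (simp_all add: lin)
qed

lemma (in lie_conformal_algebra) coeff_operation_skew:
  assumes M: "is_coeff_operation f M"
  shows "M x y + M y x = 0"
proof -
  note lin = is_coeff_operation_linear[OF M]
  have add: "u + v + (u' + v') = 0" if "u + u' = 0" "v + v' = 0" for u v u' v' :: "'a coeff_space"
    using that by (metis add.assoc add.left_commute add_0)
  have "M (coeff_symbol a m) (coeff_symbol b n) = - M (coeff_symbol b n) (coeff_symbol a m)" for a b m n
    using M unfolding is_coeff_operation_iff by (metis skew eval2_uminus eval2_swap)
  then have "M (coeff_symbol a m) (coeff_symbol b n) + M (coeff_symbol b n) (coeff_symbol a m) = 0"
    for a b m n by (metis add.left_inverse)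
  then have "M (coeff_symbol a m) y + M y (coeff_symbol a m) = 0" for a m
    by (induct y rule: coeff_space_induct)
      (simp_all add: lin add flip: coeff.scale_right_distrib)
  then show ?thesis
    by (induct x rule: coeff_space_induct)
      (simp_all add: lin add flip: coeff.scale_right_distrib)
qed

text \<open>
  Covers the Leibniz rule and, for \<open>f = g\<close>, the Jacobi identity, which says that every \<open>[x, -]\<close> is a
  derivation of the bracket itself.
\<close>

lemma coeff_operation_derivation:
  assumes B: "is_coeff_operation g B" and M: "is_coeff_operation f M"
    and leibniz: "\<And>a b c. nest_right g lam f mu a b c
      = nest_left g lam f lam_mu a b c + nest_right f mu g lam b a c"
  shows "B x (M y z) = M (B x y) z + M y (B x z)"
proof -
  note lin = is_coeff_operation_linear[OF M] is_coeff_operation_linear[OF B] coeff.scale_right_distrib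
  have "B (coeff_symbol a l) (M (coeff_symbol b m) (coeff_symbol c n))
      = M (B (coeff_symbol a l) (coeff_symbol b m)) (coeff_symbol c n)
        + M (coeff_symbol b m) (B (coeff_symbol a l) (coeff_symbol c n))" for a b c l m n
    by (simp add: eval3_nest_left[OF B M] eval3_nest_right[OF B M] eval3_nest_right_swapped[OF M B]
        leibniz eval3_add)
  then have "B (coeff_symbol a l) (M (coeff_symbol b m) z)
      = M (B (coeff_symbol a l) (coeff_symbol b m)) z
        + M (coeff_symbol b m) (B (coeff_symbol a l) z)" for a b l m
    by (induct z rule: coeff_space_induct) (simp_all add: lin)
  then have "B (coeff_symbol a l) (M y z)
      = M (B (coeff_symbol a l) y) z + M y (B (coeff_symbol a l) z)" for a l
    by (induct y rule: coeff_space_induct) (simp_all add: lin)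
  then show ?thesis
    by (induct x rule: coeff_space_induct) (simp_all add: lin)
qed

lemma (in noncommutative_poisson_conformal_algebra) noncommutative_poisson_algebra_coeff:
  assumes M: "is_coeff_operation circ M" and B: "is_coeff_operation brac B"
  shows "noncommutative_poisson_algebra coeff_scale M B"
proof
  show "bilinear_map coeff_scale coeff_scale M" "bilinear_map coeff_scale coeff_scale B"
    using M B by (simp_all add: is_coeff_operation_def)
  show "M (M x y) z = M x (M y z)" for x y z
    by (rule circ.coeff_operation_assoc[OF M])
  show "B x x = 0" for x
  proof -
    have "coeff_scale 2 (B x x) = B x x + B x x"
      using coeff.scale_left_distrib[of 1 1 "B x x"] by simp
    also have "\<dots> = 0"
      by (rule brac.coeff_operation_skew[OF B])
    finally show ?thesis by simp
  qed
  show "B x (B y z) + B y (B z x) + B z (B x y) = 0" for x y z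
  proof -
    have "B x (B y z) = B (B x y) z + B y (B x z)"
      by (rule coeff_operation_derivation[OF B B brac.jacobi])
    moreover have "B (B x y) z + B z (B x y) = 0"
      by (rule brac.coeff_operation_skew[OF B])
    moreover have "B y (B x z) + B y (B z x) = B y 0"
      by (simp only: brac.coeff_operation_skew[OF B] flip: is_coeff_operation_linear(2)[OF B])
    moreover have "B y 0 = 0"
      using is_coeff_operation_linear(4)[OF B, of y 0] by simp
    ultimately show ?thesis
      by (simp add: add_eq_0_iff2)
  qed
  show "B x (M y z) = M (B x y) z + M y (B x z)" for x y z
    by (rule coeff_operation_derivation[OF B M leibniz])
qed

theorem proposition3p6:
  fixes circ brac :: "'p::complex_del_module \<Rightarrow> 'p \<Rightarrow> 'p poly"
  shows
    "(noncommutative_poisson_conformal_algebra circ brac \<longrightarrow>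
        (\<exists>!M. is_coeff_operation circ M) \<and>
        (\<exists>!B. is_coeff_operation brac B) \<and>
        (\<forall>M B. is_coeff_operation circ M \<and> is_coeff_operation brac B \<longrightarrow>
          noncommutative_poisson_algebra coeff_scale M B)) \<and>
     (poisson_conformal_algebra circ brac \<longrightarrow>
        (\<exists>!M. is_coeff_operation circ M) \<and>
        (\<exists>!B. is_coeff_operation brac B) \<and>
        (\<forall>M B. is_coeff_operation circ M \<and> is_coeff_operation brac B \<longrightarrow>
          poisson_algebra coeff_scale M B))"
proof (intro conjI impI allI; (elim conjE)?)
  assume "noncommutative_poisson_conformal_algebra circ brac"
  then interpret noncommutative_poisson_conformal_algebra circ brac .
  show "\<exists>!M. is_coeff_operation circ M" by (rule circ.ex1_coeff_operation)
  show "\<exists>!B. is_coeff_operation brac B" by (rule brac.ex1_coeff_operation)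
  show "noncommutative_poisson_algebra coeff_scale M B"
    if "is_coeff_operation circ M" "is_coeff_operation brac B" for M B
    using that by (rule noncommutative_poisson_algebra_coeff)
next
  assume "poisson_conformal_algebra circ brac"
  then interpret poisson_conformal_algebra circ brac .
  show "\<exists>!M. is_coeff_operation circ M" by (rule circ.ex1_coeff_operation)
  show "\<exists>!B. is_coeff_operation brac B" by (rule brac.ex1_coeff_operation)
  show "poisson_algebra coeff_scale M B"
    if M: "is_coeff_operation circ M" and B: "is_coeff_operation brac B" for M B
    using noncommutative_poisson_algebra_coeff[OF M B] circ.coeff_operation_commute[OF M]
    by (auto simp: poisson_algebra_def poisson_algebra_axioms_def)
qed

end
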